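(* Let $E$ be a $k$-vector space, let $C_1,C_2\subseteq E$ be subspaces such that $(C_1,\Delta_1,\epsilon_1)$ and $(C_2,\Delta_2,\epsilon_2)$ are coassociative counital coalgebras, let $\Phi:C_1\to C_2$ be a channel map, and put $\mathbb{D}:=C_1+C_2\subseteq E$. Let $\Delta_*,\delta_1,\hat\delta_1:\mathbb{D}\to\mathbb{D}^{\otimes 2}$ be linear maps such that - $\Delta_*=\Delta_1$ on $C_1$ and $\Delta_*=\Delta_2$ on $C_2$; - $\delta_1=\Delta_1$ on $C_1$ and $\delta_1\Phi=(id\otimes\Phi)\Delta_1$; - $\hat\delta_1=\Delta_1$ on $C_1$ and $\hat\delta_1\Phi=(\Phi\otimes id)\Delta_1$. Let $(A,m)$ be an associative $k$-algebra and let $L(\mathbb{D},A)$ be the $k$-vector space of linear maps $\mathbb{D}\to A$. For $f,g\in L(\mathbb{D},A)$ put $$f\perp g:=m(f\otimes g)\Delta_*,\qquad f\dashv g:=m(f\otimes g)\hat\delta_1,\qquad f\vdash g:=m(f\otimes g)\delta_1 .$$ Then $(L(\mathbb{D},A),\dashv,\vdash)$ is an associative dialgebra; the bracket $[f,g]:=f\dashv g-g\vdash f$ makes $L(\mathbb{D},A)$ a Leibniz algebra; and $(L(\mathbb{D},A),\dashv,\vdash,\perp)$ is an associative trialgebra.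
   Context: $k$ is $\mathbb{R}$ or $\mathbb{C}$; all vector spaces have finite or countable dimension. Channel map: an invertible linear map $\Phi:C_1\to C_2$ that is a coalgebra morphism: $\Delta_2\Phi=(\Phi\otimes\Phi)\Delta_1$ and $\epsilon_2\Phi=\epsilon_1$. Associative dialgebra: a vector space with two associative bilinear products $\vdash,\dashv$ such that $x\dashv(y\dashv z)=x\dashv(y\vdash z)$, $(x\vdash y)\dashv z=x\vdash(y\dashv z)$, $(x\dashv y)\vdash z=(x\vdash y)\vdash z$. Leibniz algebra: a vector space with a bilinear bracket such that $[[x,y],z]=[[x,z],y]+[x,[y,z]]$. Associative trialgebra: an associative dialgebra with a further associative product $\perp$ such that $(x\dashv y)\dashv z=x\dashv(y\perp z)$, $(x\perp y)\dashv z=x\perp(y\dashv z)$, $(x\dashv y)\perp z=x\perp(y\vdash z)$, $(x\vdash y)\perp z=x\vdash(y\perp z)$, $(x\perp y)\vdash z=x\vdash(y\vdash z)$. The maps prescribed separately on $C_1$ and on $C_2$ are assumed to exist as linear maps on $C_1+C_2$ (automatic when $C_1\cap C_2=0$). *)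

theory Defs
  imports Complex_Main "HOL-Library.Function_Algebras" "HOL-Library.Countable_Set"
begin

section \<open>The ground field\<close>

text \<open>The fields that are isomorphic to the real or to the complex numbers.\<close>

class real_or_complex = field +
  assumes real_or_complex:
    "(\<exists>\<phi> :: 'a \<Rightarrow> real. bij \<phi> \<and> \<phi> 1 = 1 \<and>
        (\<forall>x y. \<phi> (x + y) = \<phi> x + \<phi> y \<and> \<phi> (x * y) = \<phi> x * \<phi> y)) \<or>
     (\<exists>\<phi> :: 'a \<Rightarrow> complex. bij \<phi> \<and> \<phi> 1 = 1 \<and>
        (\<forall>x y. \<phi> (x + y) = \<phi> x + \<phi> y \<and> \<phi> (x * y) = \<phi> x * \<phi> y))"

instance real :: real_or_complex
  by standard (rule disjI1, rule exI[of _ id], simp)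

instance complex :: real_or_complex
  by standard (rule disjI2, rule exI[of _ id], simp)


section \<open>Linear and bilinear maps on subspaces\<close>

definition countable_dimensional :: "('k::field \<Rightarrow> 'v \<Rightarrow> 'v::ab_group_add) \<Rightarrow> bool" where
  "countable_dimensional s \<longleftrightarrow>
     (\<exists>B. countable B \<and> \<not> module.dependent s B \<and> module.span s B = UNIV)"

definition linear_on ::
  "('k::field \<Rightarrow> 'v \<Rightarrow> 'v::ab_group_add) \<Rightarrow> 'v set \<Rightarrow>
   ('k \<Rightarrow> 'w \<Rightarrow> 'w::ab_group_add) \<Rightarrow> 'w set \<Rightarrow> ('v \<Rightarrow> 'w) \<Rightarrow> bool" where
  "linear_on s V t W f \<longleftrightarrow>
     (\<forall>x\<in>V. f x \<in> W) \<and>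
     (\<forall>x\<in>V. \<forall>y\<in>V. f (x + y) = f x + f y) \<and>
     (\<forall>c. \<forall>x\<in>V. f (s c x) = t c (f x))"

definition bilinear_on ::
  "('k::field \<Rightarrow> 'v \<Rightarrow> 'v::ab_group_add) \<Rightarrow> 'v set \<Rightarrow>
   ('k \<Rightarrow> 'w \<Rightarrow> 'w::ab_group_add) \<Rightarrow> 'w set \<Rightarrow>
   ('k \<Rightarrow> 'u \<Rightarrow> 'u::ab_group_add) \<Rightarrow> 'u set \<Rightarrow> ('v \<Rightarrow> 'w \<Rightarrow> 'u) \<Rightarrow> bool" where
  "bilinear_on s V t W r U p \<longleftrightarrow>
     (\<forall>x\<in>V. linear_on t W r U (p x)) \<and> (\<forall>y\<in>W. linear_on s V r U (\<lambda>x. p x y))"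

text \<open>A linear map defined on a subspace \<open>V\<close> only is represented by the total function that is
  \<open>0\<close> outside \<open>V\<close>. With the pointwise operations, these functions form a vector space.\<close>

definition hom_space ::
  "('k::field \<Rightarrow> 'v \<Rightarrow> 'v::ab_group_add) \<Rightarrow> 'v set \<Rightarrow>
   ('k \<Rightarrow> 'w \<Rightarrow> 'w::ab_group_add) \<Rightarrow> 'w set \<Rightarrow> ('v \<Rightarrow> 'w) set" where
  "hom_space s V t W = {f. linear_on s V t W f \<and> (\<forall>x. x \<notin> V \<longrightarrow> f x = 0)}"

definition fun_scale :: "('k \<Rightarrow> 'w \<Rightarrow> 'w) \<Rightarrow> 'k \<Rightarrow> ('x \<Rightarrow> 'w) \<Rightarrow> 'x \<Rightarrow> 'w" where
  "fun_scale t c f = (\<lambda>x. t c (f x))"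


section \<open>Tensor products\<close>

text \<open>The tensor product is realised inside the dual of the space of bilinear forms: the pure
  tensor of \<open>v\<close> and \<open>w\<close> evaluates bilinear forms at \<open>(v, w)\<close>, and the tensor product of
  subspaces \<open>V\<close> and \<open>W\<close> is the span of the pure tensors of their elements. Over a field this has
  the universal property, for all subspaces of the ambient spaces (lemma
  \<open>tensor_universal\<close> below). In particular, the tensor products of subspaces of \<open>V\<close> and \<open>W\<close> are
  literally contained in that of \<open>V\<close> and \<open>W\<close>.\<close>

type_synonym ('k, 'v, 'w) tensor = "('v \<Rightarrow> 'w \<Rightarrow> 'k) \<Rightarrow> 'k"

abbreviation tensor_scale :: "'k::field \<Rightarrow> ('k, 'v, 'w) tensor \<Rightarrow> ('k, 'v, 'w) tensor" where
  "tensor_scale \<equiv> fun_scale (*)"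

definition pure_tensor ::
  "('k::field \<Rightarrow> 'v \<Rightarrow> 'v::ab_group_add) \<Rightarrow> ('k \<Rightarrow> 'w \<Rightarrow> 'w::ab_group_add) \<Rightarrow>
   'v \<Rightarrow> 'w \<Rightarrow> ('k, 'v, 'w) tensor" where
  "pure_tensor s t v w = (\<lambda>\<beta>. if bilinear_on s UNIV t UNIV (*) UNIV \<beta> then \<beta> v w else 0)"

definition tensor_space ::
  "('k::field \<Rightarrow> 'v \<Rightarrow> 'v::ab_group_add) \<Rightarrow> 'v set \<Rightarrow>
   ('k \<Rightarrow> 'w \<Rightarrow> 'w::ab_group_add) \<Rightarrow> 'w set \<Rightarrow> ('k, 'v, 'w) tensor set" where
  "tensor_space s V t W = module.span tensor_scale {pure_tensor s t v w |v w. v \<in> V \<and> w \<in> W}"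

text \<open>The linear map on the tensor product induced by a bilinear map.\<close>

definition tensor_lift ::
  "('k::field \<Rightarrow> 'v \<Rightarrow> 'v::ab_group_add) \<Rightarrow> 'v set \<Rightarrow>
   ('k \<Rightarrow> 'w \<Rightarrow> 'w::ab_group_add) \<Rightarrow> 'w set \<Rightarrow>
   ('k \<Rightarrow> 'u \<Rightarrow> 'u::ab_group_add) \<Rightarrow> ('v \<Rightarrow> 'w \<Rightarrow> 'u) \<Rightarrow> ('k, 'v, 'w) tensor \<Rightarrow> 'u" where
  "tensor_lift s V t W r \<beta> =
     (THE \<phi>. \<phi> \<in> hom_space tensor_scale (tensor_space s V t W) r UNIV \<and>
             (\<forall>v\<in>V. \<forall>w\<in>W. \<phi> (pure_tensor s t v w) = \<beta> v w))"

text \<open>The tensor product of the maps \<open>f\<close> on \<open>V\<close> and \<open>g\<close> on \<open>W\<close>; \<open>s'\<close> and \<open>t'\<close> are the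
  scalar multiplications of the target spaces.\<close>

definition tensor_map ::
  "('k::field \<Rightarrow> 'v \<Rightarrow> 'v::ab_group_add) \<Rightarrow> 'v set \<Rightarrow>
   ('k \<Rightarrow> 'w \<Rightarrow> 'w::ab_group_add) \<Rightarrow> 'w set \<Rightarrow>
   ('k \<Rightarrow> 'x \<Rightarrow> 'x::ab_group_add) \<Rightarrow> ('k \<Rightarrow> 'y \<Rightarrow> 'y::ab_group_add) \<Rightarrow>
   ('v \<Rightarrow> 'x) \<Rightarrow> ('w \<Rightarrow> 'y) \<Rightarrow> ('k, 'v, 'w) tensor \<Rightarrow> ('k, 'x, 'y) tensor" where
  "tensor_map s V t W s' t' f g =
     tensor_lift s V t W tensor_scale (\<lambda>v w. pure_tensor s' t' (f v) (g w))"

lemma vector_space_fun_scale: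
  assumes "vector_space t"
  shows "vector_space (fun_scale t :: 'k::field \<Rightarrow> ('x \<Rightarrow> 'w::ab_group_add) \<Rightarrow> _)"
proof -
  interpret vector_space t by fact
  show ?thesis
    by unfold_locales (auto simp: fun_scale_def fun_eq_iff scale_right_distrib scale_left_distrib)
qed

lemma vector_space_self: "vector_space ((*) :: 'k::field \<Rightarrow> _)"
  by unfold_locales (auto simp: algebra_simps)

lemma tensor_universal:
  fixes s :: "'k::field \<Rightarrow> 'v \<Rightarrow> 'v::ab_group_add"
    and t :: "'k \<Rightarrow> 'w \<Rightarrow> 'w::ab_group_add"
    and r :: "'k \<Rightarrow> 'u \<Rightarrow> 'u::ab_group_add"
  assumes s: "vector_space s" and t: "vector_space t" and r: "vector_space r"
    and V: "module.subspace s V" and W: "module.subspace t W"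
    and \<beta>: "bilinear_on s V t W r UNIV \<beta>"
  shows "\<exists>!\<phi>. \<phi> \<in> hom_space tensor_scale (tensor_space s V t W) r UNIV \<and>
              (\<forall>v\<in>V. \<forall>w\<in>W. \<phi> (pure_tensor s t v w) = \<beta> v w)"
proof -
  interpret S: vector_space s by fact
  interpret T: vector_space t by fact
  interpret R: vector_space r by fact
  interpret X: vector_space "tensor_scale :: 'k \<Rightarrow> ('k, 'v, 'w) tensor \<Rightarrow> _"
    by (rule vector_space_fun_scale[OF vector_space_self])
  interpret XR: vector_space_pair "tensor_scale :: 'k \<Rightarrow> ('k, 'v, 'w) tensor \<Rightarrow> _" r ..
  let ?p = "pure_tensor s t"
  have padd1: "?p (x + y) w = ?p x w + ?p y w" and padd2: "?p v (z + z') = ?p v z + ?p v z'"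
    and pscl1: "?p (s c x) w = tensor_scale c (?p x w)"
    and pscl2: "?p v (t c z) = tensor_scale c (?p v z)" for x y w v z z' c
    by (auto simp: pure_tensor_def fun_eq_iff bilinear_on_def linear_on_def fun_scale_def)
  obtain A where A: "A \<subseteq> V" "S.independent A" "V \<subseteq> S.span A"
    using S.maximal_independent_subset[of V] by auto
  obtain B where B: "B \<subseteq> W" "T.independent B" "W \<subseteq> T.span B"
    using T.maximal_independent_subset[of W] by auto
  define A' where "A' = S.extend_basis A"
  define B' where "B' = T.extend_basis B"
  have A': "A \<subseteq> A'" "S.independent A'" "S.span A' = UNIV"
    unfolding A'_def using S.extend_basis_superset[OF A(2)] S.independent_extend_basis[OF A(2)]
      S.span_extend_basis[OF A(2)] by auto
  have B': "B \<subseteq> B'" "T.independent B'" "T.span B' = UNIV"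
    unfolding B'_def using T.extend_basis_superset[OF B(2)] T.independent_extend_basis[OF B(2)]
      T.span_extend_basis[OF B(2)] by auto
  define d where "d a b = (\<lambda>v w. S.representation A' v a * T.representation B' w b)" for a b
  have d: "bilinear_on s UNIV t UNIV (*) UNIV (d a b)" for a b
    using A' B' by (auto simp: bilinear_on_def linear_on_def d_def S.representation_add
        T.representation_add S.representation_scale T.representation_scale algebra_simps)
  have dval: "?p a b (d a0 b0) = (if a = a0 \<and> b = b0 then 1 else 0)"
    if "a \<in> A" "b \<in> B" for a b a0 b0
  proof -
    have "a \<in> A'" "b \<in> B'" using that A' B' by auto
    then show ?thesis using d[of a0 b0] A' B'
      by (auto simp: pure_tensor_def d_def S.representation_basis T.representation_basis)
  qed
  have inj: "a = a0 \<and> b = b0" if "a \<in> A" "b \<in> B" "a0 \<in> A" "b0 \<in> B" "?p a b = ?p a0 b0"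
    for a b a0 b0
    using dval[OF that(1,2), of a0 b0] dval[OF that(3,4), of a0 b0] that(5)
    by (auto split: if_splits)
  define P where "P = {?p a b |a b. a \<in> A \<and> b \<in> B}"
  have zsub: "X.subspace {q. q e = 0}" for e
    by (auto simp: X.subspace_def fun_scale_def)
  have indep: "X.independent P"
  proof
    assume "X.dependent P"
    then obtain q where q: "q \<in> P" "q \<in> X.span (P - {q})" by (auto simp: X.dependent_def)
    from q(1) obtain a b where ab: "a \<in> A" "b \<in> B" "q = ?p a b" by (auto simp: P_def)
    have "P - {q} \<subseteq> {q. q (d a b) = 0}"
      using ab dval by (auto simp: P_def)
    then have "X.span (P - {q}) \<subseteq> {q. q (d a b) = 0}"
      by (rule X.span_minimal[OF _ zsub])
    with q have "q (d a b) = 0" by auto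
    with ab dval[of a b a b] show False by auto
  qed
  define h where "h q = (SOME u. \<exists>a\<in>A. \<exists>b\<in>B. q = ?p a b \<and> u = \<beta> a b)" for q
  have h: "h (?p a b) = \<beta> a b" if "a \<in> A" "b \<in> B" for a b
    unfolding h_def using that inj by (intro some_equality) (blast+)
  obtain g where g: "Vector_Spaces.linear tensor_scale r g" "\<forall>q\<in>P. g q = h q"
    using XR.linear_independent_extend[OF indep] by blast
  interpret g: Vector_Spaces.linear tensor_scale r g by (rule g(1))
  have gab: "g (?p a b) = \<beta> a b" if "a \<in> A" "b \<in> B" for a b
  proof -
    have "?p a b \<in> P" using that by (auto simp: P_def)
    then show ?thesis using g(2) h[OF that] by simp
  qed
  have \<beta>1: "\<And>x y w. x \<in> V \<Longrightarrow> y \<in> V \<Longrightarrow> w \<in> W \<Longrightarrow> \<beta> (x + y) w = \<beta> x w + \<beta> y w"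
    "\<And>c x w. x \<in> V \<Longrightarrow> w \<in> W \<Longrightarrow> \<beta> (s c x) w = r c (\<beta> x w)"
    and \<beta>2: "\<And>v x y. v \<in> V \<Longrightarrow> x \<in> W \<Longrightarrow> y \<in> W \<Longrightarrow> \<beta> v (x + y) = \<beta> v x + \<beta> v y"
    "\<And>c v x. v \<in> V \<Longrightarrow> x \<in> W \<Longrightarrow> \<beta> v (t c x) = r c (\<beta> v x)"
    using \<beta> by (auto simp: bilinear_on_def linear_on_def)
  have z1: "\<beta> 0 w = 0" "?p 0 w = 0" if "w \<in> W" for w
    using \<beta>1(2)[of 0 w 0] that S.subspace_0[OF V] pscl1[of 0 0 w]
    by (auto simp: fun_scale_def fun_eq_iff)
  have z2: "\<beta> v 0 = 0" if "v \<in> V" for v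
    using \<beta>2(2)[of v 0 0] that T.subspace_0[OF W] by auto
  have z3: "?p v 0 = 0" for v
    using pscl2[of v 0 0] by (auto simp: fun_scale_def fun_eq_iff)
  have step1: "g (?p a w) = \<beta> a w" if a: "a \<in> A" and w: "w \<in> W" for a w
  proof -
    have aV: "a \<in> V" using a A by auto
    have "T.subspace {w \<in> W. g (?p a w) = \<beta> a w}"
      using aV T.subspace_0[OF W] T.subspace_add[OF W] T.subspace_scale[OF W]
      by (auto simp: T.subspace_def padd2 pscl2 z2 z3 \<beta>2 g.add g.scale)
    moreover have "B \<subseteq> {w \<in> W. g (?p a w) = \<beta> a w}" using B a gab by auto
    ultimately have "T.span B \<subseteq> {w \<in> W. g (?p a w) = \<beta> a w}" by (intro T.span_minimal)
    then show ?thesis using B w by auto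
  qed
  have step2: "g (?p v w) = \<beta> v w" if v: "v \<in> V" and w: "w \<in> W" for v w
  proof -
    have "S.subspace {v \<in> V. g (?p v w) = \<beta> v w}"
      using w S.subspace_0[OF V] S.subspace_add[OF V] S.subspace_scale[OF V]
      by (auto simp: S.subspace_def padd1 pscl1 z1 \<beta>1 g.add g.scale)
    moreover have "A \<subseteq> {v \<in> V. g (?p v w) = \<beta> v w}" using A w step1 by auto
    ultimately have "S.span A \<subseteq> {v \<in> V. g (?p v w) = \<beta> v w}" by (intro S.span_minimal)
    then show ?thesis using A v by auto
  qed
  let ?T = "tensor_space s V t W"
  let ?G = "{?p v w |v w. v \<in> V \<and> w \<in> W}"
  have Tsub: "X.subspace ?T" unfolding tensor_space_def by (rule X.subspace_span)
  have GT: "?p v w \<in> ?T" if "v \<in> V" "w \<in> W" for v w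
    unfolding tensor_space_def using that by (auto intro: X.span_base)
  show ?thesis
  proof (rule ex_ex1I)
    let ?f = "\<lambda>q. if q \<in> ?T then g q else 0"
    have "?f \<in> hom_space tensor_scale ?T r UNIV"
      using X.subspace_add[OF Tsub] X.subspace_scale[OF Tsub]
      by (auto simp: hom_space_def linear_on_def g.add g.scale)
    then show "\<exists>\<phi>. \<phi> \<in> hom_space tensor_scale ?T r UNIV \<and>
        (\<forall>v\<in>V. \<forall>w\<in>W. \<phi> (?p v w) = \<beta> v w)"
      using GT step2 by (intro exI[of _ ?f]) auto
  next
    fix \<phi> \<psi>
    assume \<phi>: "\<phi> \<in> hom_space tensor_scale ?T r UNIV \<and> (\<forall>v\<in>V. \<forall>w\<in>W. \<phi> (?p v w) = \<beta> v w)"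
      and \<psi>: "\<psi> \<in> hom_space tensor_scale ?T r UNIV \<and> (\<forall>v\<in>V. \<forall>w\<in>W. \<psi> (?p v w) = \<beta> v w)"
    have "X.subspace {q \<in> ?T. \<phi> q = \<psi> q}"
    proof -
      have "\<phi> (tensor_scale 0 0) = r 0 (\<phi> 0)" "\<psi> (tensor_scale 0 0) = r 0 (\<psi> 0)"
        using \<phi> \<psi> X.subspace_0[OF Tsub] unfolding hom_space_def linear_on_def by blast+
      then have "\<phi> 0 = 0" "\<psi> 0 = 0" by auto
      then show ?thesis
        using \<phi> \<psi> X.subspace_0[OF Tsub] X.subspace_add[OF Tsub] X.subspace_scale[OF Tsub]
        by (auto simp: X.subspace_def hom_space_def linear_on_def)
    qed
    moreover have "?G \<subseteq> {q \<in> ?T. \<phi> q = \<psi> q}" using \<phi> \<psi> GT by auto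
    ultimately have "X.span ?G \<subseteq> {q \<in> ?T. \<phi> q = \<psi> q}" by (intro X.span_minimal)
    then have "\<phi> q = \<psi> q" if "q \<in> ?T" for q using that unfolding tensor_space_def by auto
    moreover have "\<phi> q = \<psi> q" if "q \<notin> ?T" for q using that \<phi> \<psi> by (auto simp: hom_space_def)
    ultimately show "\<phi> = \<psi>" by blast
  qed
qed


section \<open>Coalgebras and channel maps\<close>

text \<open>The associativity isomorphism of the threefold tensor product, and the canonical
  isomorphisms of \<open>k \<otimes> V\<close> and of \<open>V \<otimes> k\<close> with \<open>V\<close>.\<close>

definition tensor_assoc ::
  "('k::field \<Rightarrow> 'v \<Rightarrow> 'v::ab_group_add) \<Rightarrow> 'v set \<Rightarrow>
   ('k, ('k, 'v, 'v) tensor, 'v) tensor \<Rightarrow> ('k, 'v, ('k, 'v, 'v) tensor) tensor" where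
  "tensor_assoc s V =
     tensor_lift tensor_scale (tensor_space s V s V) s V tensor_scale
       (\<lambda>q z. tensor_lift s V s V tensor_scale
          (\<lambda>x y. pure_tensor s tensor_scale x (pure_tensor s s y z)) q)"

definition tensor_unit_left ::
  "('k::field \<Rightarrow> 'v \<Rightarrow> 'v::ab_group_add) \<Rightarrow> 'v set \<Rightarrow> ('k, 'k, 'v) tensor \<Rightarrow> 'v" where
  "tensor_unit_left s V = tensor_lift (*) UNIV s V s (\<lambda>c x. s c x)"

definition tensor_unit_right ::
  "('k::field \<Rightarrow> 'v \<Rightarrow> 'v::ab_group_add) \<Rightarrow> 'v set \<Rightarrow> ('k, 'v, 'k) tensor \<Rightarrow> 'v" where
  "tensor_unit_right s V = tensor_lift s V (*) UNIV s (\<lambda>x c. s c x)"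

definition coalgebra ::
  "('k::field \<Rightarrow> 'v \<Rightarrow> 'v::ab_group_add) \<Rightarrow> 'v set \<Rightarrow>
   ('v \<Rightarrow> ('k, 'v, 'v) tensor) \<Rightarrow> ('v \<Rightarrow> 'k) \<Rightarrow> bool" where
  "coalgebra s C \<Delta> \<epsilon> \<longleftrightarrow>
     vector_space s \<and> module.subspace s C \<and>
     linear_on s C tensor_scale (tensor_space s C s C) \<Delta> \<and>
     linear_on s C (*) UNIV \<epsilon> \<and>
     (\<forall>c\<in>C. tensor_assoc s C (tensor_map s C s C tensor_scale s \<Delta> id (\<Delta> c)) =
             tensor_map s C s C s tensor_scale id \<Delta> (\<Delta> c)) \<and>
     (\<forall>c\<in>C. tensor_unit_left s C (tensor_map s C s C (*) s \<epsilon> id (\<Delta> c)) = c) \<and>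
     (\<forall>c\<in>C. tensor_unit_right s C (tensor_map s C s C s (*) id \<epsilon> (\<Delta> c)) = c)"

definition channel_map ::
  "('k::field \<Rightarrow> 'v \<Rightarrow> 'v::ab_group_add) \<Rightarrow>
   'v set \<Rightarrow> ('v \<Rightarrow> ('k, 'v, 'v) tensor) \<Rightarrow> ('v \<Rightarrow> 'k) \<Rightarrow>
   'v set \<Rightarrow> ('v \<Rightarrow> ('k, 'v, 'v) tensor) \<Rightarrow> ('v \<Rightarrow> 'k) \<Rightarrow> ('v \<Rightarrow> 'v) \<Rightarrow> bool" where
  "channel_map s C1 \<Delta>1 \<epsilon>1 C2 \<Delta>2 \<epsilon>2 \<Phi> \<longleftrightarrow>
     linear_on s C1 s C2 \<Phi> \<and> bij_betw \<Phi> C1 C2 \<and>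
     (\<forall>c\<in>C1. \<Delta>2 (\<Phi> c) = tensor_map s C1 s C1 s s \<Phi> \<Phi> (\<Delta>1 c)) \<and>
     (\<forall>c\<in>C1. \<epsilon>2 (\<Phi> c) = \<epsilon>1 c)"


section \<open>Algebraic structures on a subspace\<close>

definition assoc_algebra ::
  "('k::field \<Rightarrow> 'v \<Rightarrow> 'v::ab_group_add) \<Rightarrow> 'v set \<Rightarrow> ('v \<Rightarrow> 'v \<Rightarrow> 'v) \<Rightarrow> bool" where
  "assoc_algebra s V p \<longleftrightarrow>
     vector_space s \<and> module.subspace s V \<and> bilinear_on s V s V s V p \<and>
     (\<forall>x\<in>V. \<forall>y\<in>V. \<forall>z\<in>V. p (p x y) z = p x (p y z))"

text \<open>In the following two definitions, \<open>l\<close> is the product \<open>\<stileturn>\<close>, \<open>r\<close> is the product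
  \<open>\<turnstile>\<close> and \<open>p\<close> is the product \<open>\<bottom>\<close>.\<close>

definition assoc_dialgebra ::
  "('k::field \<Rightarrow> 'v \<Rightarrow> 'v::ab_group_add) \<Rightarrow> 'v set \<Rightarrow>
   ('v \<Rightarrow> 'v \<Rightarrow> 'v) \<Rightarrow> ('v \<Rightarrow> 'v \<Rightarrow> 'v) \<Rightarrow> bool" where
  "assoc_dialgebra s V l r \<longleftrightarrow>
     assoc_algebra s V l \<and> assoc_algebra s V r \<and>
     (\<forall>x\<in>V. \<forall>y\<in>V. \<forall>z\<in>V.
        l x (l y z) = l x (r y z) \<and>
        l (r x y) z = r x (l y z) \<and>
        r (l x y) z = r (r x y) z)"

definition assoc_trialgebra ::
  "('k::field \<Rightarrow> 'v \<Rightarrow> 'v::ab_group_add) \<Rightarrow> 'v set \<Rightarrow>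
   ('v \<Rightarrow> 'v \<Rightarrow> 'v) \<Rightarrow> ('v \<Rightarrow> 'v \<Rightarrow> 'v) \<Rightarrow> ('v \<Rightarrow> 'v \<Rightarrow> 'v) \<Rightarrow> bool" where
  "assoc_trialgebra s V l r p \<longleftrightarrow>
     assoc_dialgebra s V l r \<and> assoc_algebra s V p \<and>
     (\<forall>x\<in>V. \<forall>y\<in>V. \<forall>z\<in>V.
        l (l x y) z = l x (p y z) \<and>
        l (p x y) z = p x (l y z) \<and>
        p (l x y) z = p x (r y z) \<and>
        p (r x y) z = r x (p y z) \<and>
        r (p x y) z = r x (r y z))"

definition leibniz_algebra ::
  "('k::field \<Rightarrow> 'v \<Rightarrow> 'v::ab_group_add) \<Rightarrow> 'v set \<Rightarrow> ('v \<Rightarrow> 'v \<Rightarrow> 'v) \<Rightarrow> bool" where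
  "leibniz_algebra s V b \<longleftrightarrow>
     vector_space s \<and> module.subspace s V \<and> bilinear_on s V s V s V b \<and>
     (\<forall>x\<in>V. \<forall>y\<in>V. \<forall>z\<in>V. b (b x y) z = b (b x z) y + b x (b y z))"


section \<open>Convolution products\<close>

text \<open>The map \<open>m (f \<otimes> g) \<delta>\<close> on the subspace \<open>D\<close>, extended by \<open>0\<close> as in \<open>hom_space\<close>, where
  \<open>m\<close> is the linear map on the tensor square induced by the multiplication \<open>mult\<close>.\<close>

definition convolution ::
  "('k::field \<Rightarrow> 'v \<Rightarrow> 'v::ab_group_add) \<Rightarrow> 'v set \<Rightarrow>
   ('k \<Rightarrow> 'a \<Rightarrow> 'a::ab_group_add) \<Rightarrow> ('a \<Rightarrow> 'a \<Rightarrow> 'a) \<Rightarrow>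
   ('v \<Rightarrow> ('k, 'v, 'v) tensor) \<Rightarrow> ('v \<Rightarrow> 'a) \<Rightarrow> ('v \<Rightarrow> 'a) \<Rightarrow> 'v \<Rightarrow> 'a" where
  "convolution s D t mult \<delta> f g =
     (\<lambda>x. if x \<in> D
          then tensor_lift t UNIV t UNIV t mult (tensor_map s D s D t t f g (\<delta> x))
          else 0)"

end

theory Submission
  imports Defs
begin

text \<open>Restriction to \<open>C1\<close> and composition with \<open>\<Phi>\<close> attach to a linear map \<open>f\<close> on \<open>C1 + C2\<close> a pair
  \<open>(f\<^sub>1, f\<^sub>2)\<close> of elements of the convolution algebra of \<open>C1\<close>, and \<open>f\<close> is determined by this
  pair. In terms of pairs, the three products are
  \<open>f \<bottom> g = (f\<^sub>1 g\<^sub>1, f\<^sub>2 g\<^sub>2)\<close>, \<open>f \<stileturn> g = (f\<^sub>1 g\<^sub>1, f\<^sub>2 g\<^sub>1)\<close> and \<open>f \<turnstile> g = (f\<^sub>1 g\<^sub>1, f\<^sub>1 g\<^sub>2)\<close>, so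
  that all identities follow from the associativity of the convolution on \<open>C1\<close>.\<close>

section \<open>Linear maps on subspaces\<close>

text \<open>Packs an ambient vector space and a subspace into one hypothesis, which lemmas can take
  as a premise and proofs can interpret.\<close>

locale linear_subspace = vector_space s
  for s :: "'k::field \<Rightarrow> 'v::ab_group_add \<Rightarrow> 'v" +
  fixes V :: "'v set"
  assumes subspace: "subspace V"

lemma linear_subspace_UNIV: "vector_space s \<Longrightarrow> linear_subspace s UNIV"
  by (simp add: linear_subspace_def linear_subspace_axioms_def module.subspace_UNIV
      module_iff_vector_space)

text \<open>\<open>linear_on\<close> does not mention \<open>0\<close>: the value comes from scaling
  by \<open>0\<close>, applied to the element \<open>0\<close> of \<open>V\<close>.\<close>

lemma linear_on_0:
  assumes "linear_subspace s V" "vector_space t" "linear_on s V t W f"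
  shows "f 0 = 0"
proof -
  interpret V: linear_subspace s V by fact
  interpret t: vector_space t by fact
  show ?thesis
    using assms(3) V.subspace_0[OF V.subspace] unfolding linear_on_def
    by (metis V.scale_zero_left t.scale_zero_left)
qed

lemma linear_on_mono:
  "linear_on s V t W f \<Longrightarrow> V' \<subseteq> V \<Longrightarrow> f ` V' \<subseteq> W' \<Longrightarrow> linear_on s V' t W' f"
  unfolding linear_on_def by (auto simp: subset_iff)

lemma linear_on_comp:
  "linear_on s V t W f \<Longrightarrow> linear_on t W r U g \<Longrightarrow> linear_on s V r U (\<lambda>x. g (f x))"
  unfolding linear_on_def by auto

lemma linear_on_id: "V \<subseteq> W \<Longrightarrow> linear_on s V s W id"
  unfolding linear_on_def by auto

lemma linear_on_add:
  assumes "vector_space t" "linear_on s V t UNIV f" "linear_on s V t UNIV g"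
  shows "linear_on s V t UNIV (\<lambda>x. f x + g x)"
proof -
  interpret vector_space t by fact
  show ?thesis using assms(2,3) by (auto simp: linear_on_def scale_right_distrib algebra_simps)
qed

lemma linear_on_scale:
  assumes "vector_space t" "linear_on s V t UNIV f"
  shows "linear_on s V t UNIV (\<lambda>x. t c (f x))"
proof -
  interpret vector_space t by fact
  show ?thesis using assms(2)
    by (auto simp: linear_on_def scale_right_distrib mult.commute)
qed

text \<open>The points of the span where \<open>f\<close> and \<open>g\<close> agree form a subspace
  containing \<open>G\<close>. It is formed inside the span, since the maps are linear only
  there.\<close>

lemma linear_on_span_eq:
  assumes s: "vector_space s" and t: "vector_space t"
    and f: "linear_on s (module.span s G) t W f" and g: "linear_on s (module.span s G) t W g"
    and eq: "\<And>x. x \<in> G \<Longrightarrow> f x = g x" and x: "x \<in> module.span s G"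
  shows "f x = g x"
proof -
  interpret s: vector_space s by fact
  have sub: "linear_subspace s (s.span G)"
    by unfold_locales (rule s.subspace_span)
  have "s.subspace {x \<in> s.span G. f x = g x}"
    using f g linear_on_0[OF sub t f] linear_on_0[OF sub t g]
    by (auto simp: s.subspace_def linear_on_def s.span_add s.span_scale s.span_zero)
  then have "s.span G \<subseteq> {x \<in> s.span G. f x = g x}"
    by (intro s.span_minimal) (auto simp: eq s.span_base)
  with x show ?thesis by auto
qed

text \<open>The preimage of \<open>U\<close> in the span is a subspace containing \<open>G\<close>.
  This serves to shrink the codomain of a lifted map.\<close>

lemma linear_on_span_into:
  assumes s: "vector_space s" and U: "linear_subspace t U"
    and f: "linear_on s (module.span s G) t W f"
    and into: "\<And>x. x \<in> G \<Longrightarrow> f x \<in> U" and x: "x \<in> module.span s G"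
  shows "f x \<in> U"
proof -
  interpret s: vector_space s by fact
  interpret U: linear_subspace t U by fact
  have sub: "linear_subspace s (s.span G)"
    by unfold_locales (rule s.subspace_span)
  have "s.subspace {x \<in> s.span G. f x \<in> U}"
    using f linear_on_0[OF sub U.vector_space_axioms f] U.subspace
    by (auto simp: s.subspace_def linear_on_def s.span_add s.span_scale s.span_zero
        U.subspace_0 U.subspace_add U.subspace_scale)
  then have "s.span G \<subseteq> {x \<in> s.span G. f x \<in> U}"
    by (intro s.span_minimal) (auto simp: into s.span_base)
  with x show ?thesis by auto
qed

lemma bilinear_on_comp:
  assumes "bilinear_on s' V' t' W' r U \<beta>" "linear_on s V s' V' f" "linear_on t W t' W' g"
  shows "bilinear_on s V t W r U (\<lambda>x y. \<beta> (f x) (g y))"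
  using assms unfolding bilinear_on_def linear_on_def by auto

lemma fun_scale_apply: "fun_scale t c f x = t c (f x)"
  by (simp add: fun_scale_def)

lemma linear_subspace_hom_space:
  assumes "linear_subspace s V" "vector_space t"
  shows "linear_subspace (fun_scale t) (hom_space s V t UNIV)"
proof -
  interpret V: linear_subspace s V by fact
  interpret t: vector_space t by fact
  interpret F: vector_space "fun_scale t :: _ \<Rightarrow> ('b \<Rightarrow> 'c) \<Rightarrow> _"
    by (rule vector_space_fun_scale[OF assms(2)])
  show ?thesis
    using V.subspace
    by unfold_locales
      (auto simp: F.subspace_def hom_space_def linear_on_def fun_scale_def V.subspace_add
        V.subspace_scale t.scale_right_distrib mult.commute algebra_simps)
qed


section \<open>Maps on tensor products\<close>

lemma vector_space_tensor: "vector_space (tensor_scale :: 'k::field \<Rightarrow> ('k, 'v, 'w) tensor \<Rightarrow> _)"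
  by (rule vector_space_fun_scale[OF vector_space_self])

lemma module_tensor: "module (tensor_scale :: 'k::field \<Rightarrow> ('k, 'v, 'w) tensor \<Rightarrow> _)"
  by (simp add: module_iff_vector_space vector_space_tensor)

lemma linear_subspace_tensor: "linear_subspace tensor_scale (tensor_space s V t W)"
proof -
  interpret X: vector_space "tensor_scale :: 'a \<Rightarrow> ('a, 'b, 'c) tensor \<Rightarrow> _"
    by (rule vector_space_tensor)
  show ?thesis
    unfolding tensor_space_def by unfold_locales (rule X.subspace_span)
qed

lemma pure_tensor_in: "v \<in> V \<Longrightarrow> w \<in> W \<Longrightarrow> pure_tensor s t v w \<in> tensor_space s V t W"
  unfolding tensor_space_def by (intro module.span_base[OF module_tensor]) blast

lemma bilinear_pure_tensor:
  "bilinear_on s V t W tensor_scale (tensor_space s V t W) (pure_tensor s t)"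
  by (auto simp: bilinear_on_def linear_on_def pure_tensor_in)
    (auto simp: pure_tensor_def fun_eq_iff bilinear_on_def linear_on_def fun_scale_def)

lemma tensor_eqI:
  assumes "vector_space r"
    and "linear_on tensor_scale (tensor_space s V t W) r U f"
    and "linear_on tensor_scale (tensor_space s V t W) r U g"
    and "\<And>v w. v \<in> V \<Longrightarrow> w \<in> W \<Longrightarrow> f (pure_tensor s t v w) = g (pure_tensor s t v w)"
    and "q \<in> tensor_space s V t W"
  shows "f q = g q"
  by (rule linear_on_span_eq[OF vector_space_tensor assms(1) assms(2,3)[unfolded tensor_space_def]
        _ assms(5)[unfolded tensor_space_def]]) (auto simp: assms(4))

context
  fixes s :: "'k::field \<Rightarrow> 'v \<Rightarrow> 'v::ab_group_add" and V :: "'v set"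
    and t :: "'k \<Rightarrow> 'w \<Rightarrow> 'w::ab_group_add" and W :: "'w set"
  assumes V: "linear_subspace s V" and W: "linear_subspace t W"
begin

text \<open>\<open>tensor_lift\<close> is a definite description; \<open>tensor_universal\<close>
  provides the existence and uniqueness that give access to it. All later reasoning about lifts
  rests on these two facts.\<close>

lemma
  assumes r: "vector_space r" and \<beta>: "bilinear_on s V t W r UNIV \<beta>"
  shows tensor_lift_linear:
      "linear_on tensor_scale (tensor_space s V t W) r UNIV (tensor_lift s V t W r \<beta>)"
    and tensor_lift_pure:
      "v \<in> V \<Longrightarrow> w \<in> W \<Longrightarrow> tensor_lift s V t W r \<beta> (pure_tensor s t v w) = \<beta> v w"
proof -
  have "vector_space s" "vector_space t" "module.subspace s V" "module.subspace t W"
    using V W by (auto simp: linear_subspace_def linear_subspace_axioms_def)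
  from theI'[OF tensor_universal[OF this(1,2) r this(3,4) \<beta>]]
  show "linear_on tensor_scale (tensor_space s V t W) r UNIV (tensor_lift s V t W r \<beta>)"
    and "v \<in> V \<Longrightarrow> w \<in> W \<Longrightarrow> tensor_lift s V t W r \<beta> (pure_tensor s t v w) = \<beta> v w"
    unfolding tensor_lift_def hom_space_def by blast+
qed

lemma tensor_lift_linear_into:
  assumes U: "linear_subspace r U" and \<beta>: "bilinear_on s V t W r U \<beta>"
  shows "linear_on tensor_scale (tensor_space s V t W) r U (tensor_lift s V t W r \<beta>)"
proof -
  have r: "vector_space r" using U by (simp add: linear_subspace_def)
  have \<beta>': "bilinear_on s V t W r UNIV \<beta>"
    using \<beta> by (auto simp: bilinear_on_def linear_on_def)
  note lin = tensor_lift_linear[OF r \<beta>']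
  have "tensor_lift s V t W r \<beta> q \<in> U" if "q \<in> tensor_space s V t W" for q
    by (rule linear_on_span_into[OF vector_space_tensor U lin[unfolded tensor_space_def]
          _ that[unfolded tensor_space_def]])
      (insert \<beta>, auto simp: tensor_lift_pure[OF r \<beta>'] bilinear_on_def linear_on_def)
  then show ?thesis by (intro linear_on_mono[OF lin]) auto
qed

lemma tensor_lift_eqI:
  assumes "vector_space r" "bilinear_on s V t W r UNIV \<beta>"
    and "linear_on tensor_scale (tensor_space s V t W) r UNIV f"
    and "\<And>v w. v \<in> V \<Longrightarrow> w \<in> W \<Longrightarrow> f (pure_tensor s t v w) = \<beta> v w"
    and "q \<in> tensor_space s V t W"
  shows "f q = tensor_lift s V t W r \<beta> q"
  by (rule tensor_eqI[OF assms(1,3) tensor_lift_linear[OF assms(1,2)] _ assms(5)])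
    (simp add: assms(4) tensor_lift_pure[OF assms(1,2)])

lemma
  assumes f: "linear_on s V s' V' f" and g: "linear_on t W t' W' g"
  shows tensor_map_linear: "linear_on tensor_scale (tensor_space s V t W)
      tensor_scale (tensor_space s' V' t' W') (tensor_map s V t W s' t' f g)"
    and tensor_map_pure: "v \<in> V \<Longrightarrow> w \<in> W \<Longrightarrow>
      tensor_map s V t W s' t' f g (pure_tensor s t v w) = pure_tensor s' t' (f v) (g w)"
proof -
  have \<beta>: "bilinear_on s V t W tensor_scale (tensor_space s' V' t' W')
      (\<lambda>v w. pure_tensor s' t' (f v) (g w))"
    by (rule bilinear_on_comp[OF bilinear_pure_tensor f g])
  then have \<beta>': "bilinear_on s V t W tensor_scale UNIV (\<lambda>v w. pure_tensor s' t' (f v) (g w))"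
    by (auto simp: bilinear_on_def linear_on_def)
  show "linear_on tensor_scale (tensor_space s V t W)
      tensor_scale (tensor_space s' V' t' W') (tensor_map s V t W s' t' f g)"
    unfolding tensor_map_def by (rule tensor_lift_linear_into[OF linear_subspace_tensor \<beta>])
  show "v \<in> V \<Longrightarrow> w \<in> W \<Longrightarrow>
      tensor_map s V t W s' t' f g (pure_tensor s t v w) = pure_tensor s' t' (f v) (g w)"
    unfolding tensor_map_def by (rule tensor_lift_pure[OF vector_space_tensor \<beta>'])
qed

text \<open>Naturality: both sides are linear in \<open>q\<close> and send
  \<open>pure_tensor s t v w\<close> to \<open>\<beta> (f v) (g w)\<close>. It replaces a lift after
  a \<open>tensor_map\<close> by a single lift.\<close>

lemma tensor_lift_map:
  assumes V': "linear_subspace s' V'" and W': "linear_subspace t' W'" and r: "vector_space r"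
    and f: "linear_on s V s' V' f" and g: "linear_on t W t' W' g"
    and \<beta>: "bilinear_on s' V' t' W' r UNIV \<beta>" and q: "q \<in> tensor_space s V t W"
  shows "tensor_lift s' V' t' W' r \<beta> (tensor_map s V t W s' t' f g q) =
         tensor_lift s V t W r (\<lambda>v w. \<beta> (f v) (g w)) q"
proof (rule tensor_lift_eqI[OF r bilinear_on_comp[OF \<beta> f g] _ _ q])
  \<comment> \<open>Inside the context the plain lemma names are fixed to \<open>V\<close> and
    \<open>W\<close>; the qualified ones are the general forms, instantiated here at
    \<open>V'\<close> and \<open>W'\<close>.\<close>
  show "linear_on tensor_scale (tensor_space s V t W) r UNIV
     (\<lambda>q. tensor_lift s' V' t' W' r \<beta> (tensor_map s V t W s' t' f g q))"
    by (rule linear_on_comp[OF tensor_map_linear[OF f g]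
          Submission.tensor_lift_linear[OF V' W' r \<beta>]])
  show "tensor_lift s' V' t' W' r \<beta> (tensor_map s V t W s' t' f g (pure_tensor s t v w))
      = \<beta> (f v) (g w)" if "v \<in> V" "w \<in> W" for v w
    using that f g
    by (simp add: tensor_map_pure[OF f g] linear_on_def
        Submission.tensor_lift_pure[OF V' W' r \<beta>])
qed

lemma tensor_lift_cong:
  assumes r: "vector_space r" and \<beta>: "bilinear_on s V t W r UNIV \<beta>"
    and \<gamma>: "bilinear_on s V t W r UNIV \<gamma>"
    and eq: "\<And>v w. v \<in> V \<Longrightarrow> w \<in> W \<Longrightarrow> \<beta> v w = \<gamma> v w" and q: "q \<in> tensor_space s V t W"
  shows "tensor_lift s V t W r \<beta> q = tensor_lift s V t W r \<gamma> q"
  by (rule tensor_lift_eqI[OF r \<gamma> tensor_lift_linear[OF r \<beta>] _ q])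
    (simp add: tensor_lift_pure[OF r \<beta>] eq)

text \<open>Together with \<open>tensor_lift_scale\<close>: a lift depends linearly on the bilinear
  map, which is the source of the bilinearity of convolution.\<close>

lemma tensor_lift_add:
  assumes r: "vector_space r" and \<beta>: "bilinear_on s V t W r UNIV \<beta>"
    and \<gamma>: "bilinear_on s V t W r UNIV \<gamma>" and q: "q \<in> tensor_space s V t W"
  shows "tensor_lift s V t W r (\<lambda>v w. \<beta> v w + \<gamma> v w) q =
    tensor_lift s V t W r \<beta> q + tensor_lift s V t W r \<gamma> q"
proof -
  have "bilinear_on s V t W r UNIV (\<lambda>v w. \<beta> v w + \<gamma> v w)"
    using \<beta> \<gamma> by (auto simp: bilinear_on_def intro!: linear_on_add[OF r])
  from tensor_lift_eqI[OF r this linear_on_add[OF r tensor_lift_linear[OF r \<beta>]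
        tensor_lift_linear[OF r \<gamma>]] _ q]
  show ?thesis by (simp add: tensor_lift_pure[OF r \<beta>] tensor_lift_pure[OF r \<gamma>])
qed

lemma tensor_lift_scale:
  assumes r: "vector_space r" and \<beta>: "bilinear_on s V t W r UNIV \<beta>"
    and q: "q \<in> tensor_space s V t W"
  shows "tensor_lift s V t W r (\<lambda>v w. r c (\<beta> v w)) q = r c (tensor_lift s V t W r \<beta> q)"
proof -
  have "bilinear_on s V t W r UNIV (\<lambda>v w. r c (\<beta> v w))"
    using \<beta> by (auto simp: bilinear_on_def intro!: linear_on_scale[OF r])
  from tensor_lift_eqI[OF r this linear_on_scale[OF r tensor_lift_linear[OF r \<beta>]] _ q]
  show ?thesis by (simp add: tensor_lift_pure[OF r \<beta>])
qed

end


section \<open>Convolution algebras\<close>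

text \<open>Of \<open>\<delta>\<close> only linearity is assumed, so that one locale serves both the
  comultiplication of \<open>C1\<close> and the three maps on \<open>C1 + C2\<close>.\<close>

locale convolution_space = linear_subspace s D
  for s :: "'k::field \<Rightarrow> 'v \<Rightarrow> 'v::ab_group_add" and D :: "'v set" +
  fixes t :: "'k \<Rightarrow> 'a \<Rightarrow> 'a::ab_group_add" and mult :: "'a \<Rightarrow> 'a \<Rightarrow> 'a"
    and \<delta> :: "'v \<Rightarrow> ('k, 'v, 'v) tensor"
  assumes alg: "assoc_algebra t UNIV mult"
    and \<delta>: "linear_on s D tensor_scale (tensor_space s D s D) \<delta>"
begin

abbreviation "H \<equiv> hom_space s D t UNIV"

lemma target: "vector_space t" and mult: "bilinear_on t UNIV t UNIV t UNIV mult"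
  using alg by (auto simp: assoc_algebra_def)

sublocale t: vector_space t by (rule target)

lemma \<delta>_in: "x \<in> D \<Longrightarrow> \<delta> x \<in> tensor_space s D s D"
  using \<delta> by (auto simp: linear_on_def)

lemma bilinear_mult:
  "linear_on s' V t UNIV f \<Longrightarrow> linear_on t' W t UNIV g \<Longrightarrow>
    bilinear_on s' V t' W t UNIV (\<lambda>x y. mult (f x) (g y))"
  by (rule bilinear_on_comp[OF mult])

lemma hom_linear: "f \<in> H \<Longrightarrow> linear_on s D t UNIV f"
  by (simp add: hom_space_def)

text \<open>\<open>tensor_lift_map\<close> merges \<open>mult\<close> and the tensor product of
  \<open>f\<close> and \<open>g\<close> into one lift, so the tensor square of the target disappears
  from later arguments.\<close>

lemma convolution_eq_lift:
  assumes "linear_on s D t UNIV f" "linear_on s D t UNIV g" "x \<in> D"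
  shows "convolution s D t mult \<delta> f g x =
    tensor_lift s D s D t (\<lambda>v w. mult (f v) (g w)) (\<delta> x)"
  using assms linear_subspace_axioms linear_subspace_UNIV[OF target] target mult \<delta>_in
  by (simp add: convolution_def tensor_lift_map)

lemma convolution_in:
  assumes "f \<in> H" "g \<in> H"
  shows "convolution s D t mult \<delta> f g \<in> H"
proof -
  note fg = hom_linear[OF assms(1)] hom_linear[OF assms(2)]
  note L = linear_subspace_axioms
  have "linear_on s D t UNIV (\<lambda>x. tensor_lift s D s D t (\<lambda>v w. mult (f v) (g w)) (\<delta> x))"
    by (rule linear_on_comp[OF \<delta> tensor_lift_linear[OF L L target bilinear_mult[OF fg]]])
  then have "linear_on s D t UNIV (convolution s D t mult \<delta> f g)"
    unfolding linear_on_def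
    by (simp add: convolution_eq_lift[OF fg] subspace_add[OF subspace] subspace_scale[OF subspace])
  then show ?thesis by (simp add: hom_space_def convolution_def)
qed

lemma H_subspace: "linear_subspace (fun_scale t) H"
  by (rule linear_subspace_hom_space[OF linear_subspace_axioms target])

lemma mult_simps:
  "mult (x + y) z = mult x z + mult y z" "mult z (x + y) = mult z x + mult z y"
  "mult (t c x) z = t c (mult x z)" "mult z (t c x) = t c (mult z x)"
  "mult (mult x y) z = mult x (mult y z)"
  using alg by (auto simp: assoc_algebra_def bilinear_on_def linear_on_def)

text \<open>By \<open>mult_simps\<close>, a sum or multiple in one argument becomes a sum or
  multiple of the bilinear maps under the lift, and the lift is linear in these.\<close>

lemma bilinear_convolution:
  "bilinear_on (fun_scale t) H (fun_scale t) H (fun_scale t) H (convolution s D t mult \<delta>)"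
proof -
  interpret H: linear_subspace "fun_scale t" H by (rule H_subspace)
  note L = linear_subspace_axioms
  note add = tensor_lift_add[OF L L target bilinear_mult bilinear_mult]
  note scale = tensor_lift_scale[OF L L target bilinear_mult]
  have eq: "convolution s D t mult \<delta> f g x = (if x \<in> D then
      tensor_lift s D s D t (\<lambda>v w. mult (f v) (g w)) (\<delta> x) else 0)"
    if "f \<in> H" "g \<in> H" for f g x
    using convolution_eq_lift[OF that[THEN hom_linear]] by (simp add: convolution_def)
  have "convolution s D t mult \<delta> (f + g) h =
      convolution s D t mult \<delta> f h + convolution s D t mult \<delta> g h"
    "convolution s D t mult \<delta> h (f + g) =
      convolution s D t mult \<delta> h f + convolution s D t mult \<delta> h g"
    if fgh: "f \<in> H" "g \<in> H" "h \<in> H" for f g h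
    using fgh fgh[THEN hom_linear] H.subspace_add[OF H.subspace fgh(1,2)]
    by (simp_all add: fun_eq_iff eq mult_simps add \<delta>_in)
  moreover have "convolution s D t mult \<delta> (fun_scale t c f) h =
      fun_scale t c (convolution s D t mult \<delta> f h)"
    "convolution s D t mult \<delta> h (fun_scale t c f) =
      fun_scale t c (convolution s D t mult \<delta> h f)"
    if fh: "f \<in> H" "h \<in> H" for f h c
    using fh fh[THEN hom_linear] H.subspace_scale[OF H.subspace fh(1), of c]
    by (simp_all add: fun_eq_iff eq fun_scale_apply mult_simps scale \<delta>_in)
  ultimately show ?thesis
    unfolding bilinear_on_def linear_on_def by (simp add: convolution_in)
qed

end

text \<open>This is the convolution algebra of a coalgebra: both sides evaluate one trilinear
  expression at an iterated comultiplication of \<open>c\<close>. The two bracketings of the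
  threefold tensor product have different types, so they are compared through
  \<open>tensor_assoc\<close>.\<close>

lemma convolution_assoc:
  fixes s :: "'k::field \<Rightarrow> 'v \<Rightarrow> 'v::ab_group_add"
    and t :: "'k \<Rightarrow> 'a \<Rightarrow> 'a::ab_group_add"
  assumes coalg: "coalgebra s C \<Delta> \<epsilon>" and alg: "assoc_algebra t UNIV mult"
    and f: "f \<in> hom_space s C t UNIV" and g: "g \<in> hom_space s C t UNIV"
    and h: "h \<in> hom_space s C t UNIV"
  shows "convolution s C t mult \<Delta> (convolution s C t mult \<Delta> f g) h =
    convolution s C t mult \<Delta> f (convolution s C t mult \<Delta> g h)"
proof (rule ext)
  fix c
  interpret convolution_space s C t mult \<Delta>
    using coalg alg
    by (simp add: coalgebra_def convolution_space_def convolution_space_axioms_def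
        linear_subspace_def linear_subspace_axioms_def)
  note L = linear_subspace_axioms
  note X = linear_subspace_tensor[of s C s C]
  let ?conv = "convolution s C t mult \<Delta>"
  let ?T = "tensor_space s C s C"
  \<comment> \<open>The convolution of \<open>p\<close> and \<open>q\<close> before composition with
    \<open>\<Delta>\<close>. It accepts arbitrary tensors, as \<open>N\<close> and \<open>N'\<close>
    require.\<close>
  define M where "M p q = tensor_lift s C s C t (\<lambda>v w. mult (p v) (q w))" for p q
  have M: "linear_on tensor_scale ?T t UNIV (M p q)" if "p \<in> H" "q \<in> H" for p q
    unfolding M_def by (rule tensor_lift_linear[OF L L target bilinear_mult[OF that[THEN hom_linear]]])
  have M_pure: "M p q (pure_tensor s s v w) = mult (p v) (q w)"
    if "p \<in> H" "q \<in> H" "v \<in> C" "w \<in> C" for p q v w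
    unfolding M_def
    by (rule tensor_lift_pure[OF L L target bilinear_mult[OF that(1,2)[THEN hom_linear]] that(3,4)])
  have conv: "?conv p q x = M p q (\<Delta> x)" if "p \<in> H" "q \<in> H" "x \<in> C" for p q x
    unfolding M_def using that by (intro convolution_eq_lift hom_linear)
  txt \<open>\<open>N\<close> and \<open>N'\<close> are the maps \<open>x \<otimes> (y \<otimes> z) \<mapsto> f x (g y h z)\<close> and
    \<open>(x \<otimes> y) \<otimes> z \<mapsto> (f x g y) h z\<close>; associativity of \<open>mult\<close> says that
    \<open>tensor_assoc\<close> carries \<open>N'\<close> to \<open>N\<close>, and coassociativity gives the claim.\<close>
  define N where
    "N = tensor_lift s C tensor_scale ?T t (\<lambda>x q. mult (f x) (M g h q))"
  have bN: "bilinear_on s C tensor_scale ?T t UNIV (\<lambda>x q. mult (f x) (M g h q))"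
    by (intro bilinear_mult hom_linear M f g h)
  note N = tensor_lift_linear[OF L X target bN, folded N_def]
  note N_pure = tensor_lift_pure[OF L X target bN, folded N_def]
  define N' where
    "N' = tensor_lift tensor_scale ?T s C t (\<lambda>q z. mult (M f g q) (h z))"
  have bN': "bilinear_on tensor_scale ?T s C t UNIV (\<lambda>q z. mult (M f g q) (h z))"
    by (intro bilinear_mult hom_linear M f g h)
  note N' = tensor_lift_linear[OF X L target bN', folded N'_def]
  note N'_pure = tensor_lift_pure[OF X L target bN', folded N'_def]
  txt \<open>\<open>?a z\<close> is \<open>tensor_assoc\<close> on the tensors \<open>q \<otimes> z\<close>. The value of \<open>tensor_assoc\<close>, a definite
    description, is only known once \<open>?a z q\<close> has been shown to be bilinear in \<open>q\<close> and \<open>z\<close>.\<close>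
  let ?a = "\<lambda>z. tensor_lift s C s C tensor_scale
    (\<lambda>x y. pure_tensor s tensor_scale x (pure_tensor s s y z))"
  let ?CT = "tensor_space s C tensor_scale ?T"
  have ba: "bilinear_on s C s C tensor_scale ?CT
      (\<lambda>x y. pure_tensor s tensor_scale x (pure_tensor s s y z))" if "z \<in> C" for z
    using that bilinear_pure_tensor[of s C s C]
    by (intro bilinear_on_comp[OF bilinear_pure_tensor, of s C s C id, simplified])
      (auto simp: bilinear_on_def linear_on_id)
  then have ba': "bilinear_on s C s C tensor_scale UNIV
      (\<lambda>x y. pure_tensor s tensor_scale x (pure_tensor s s y z))" if "z \<in> C" for z
    using that unfolding bilinear_on_def linear_on_def by blast
  note a = tensor_lift_linear_into[OF L L linear_subspace_tensor ba]
  note a' = tensor_lift_linear[OF L L vector_space_tensor ba']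
  note a_pure = tensor_lift_pure[OF L L vector_space_tensor ba']
  \<comment> \<open>\<open>pure_tensor\<close> is bilinear on the whole ambient spaces;
    instantiating with \<open>UNIV\<close> avoids membership conditions.\<close>
  have pure: "pure_tensor s tensor_scale x (pure_tensor s s y (z + z')) =
      pure_tensor s tensor_scale x (pure_tensor s s y z) +
      pure_tensor s tensor_scale x (pure_tensor s s y z')"
    "pure_tensor s tensor_scale x (pure_tensor s s y (s k z)) =
      tensor_scale k (pure_tensor s tensor_scale x (pure_tensor s s y z))" for x y z z' k
    using bilinear_pure_tensor[of s UNIV s UNIV]
      bilinear_pure_tensor[of s UNIV tensor_scale "tensor_space s UNIV s UNIV"]
    by (simp_all add: bilinear_on_def linear_on_def pure_tensor_in)
  \<comment> \<open>Linearity in \<open>z\<close> at a general \<open>q\<close>: both sides are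
    linear in \<open>q\<close>, so pure tensors \<open>q\<close> suffice.\<close>
  have a_add: "?a (z + z') q = ?a z q + ?a z' q" if "z \<in> C" "z' \<in> C" "q \<in> ?T" for z z' q
  proof (rule tensor_eqI[where f = "?a (z + z')" and g = "\<lambda>q. ?a z q + ?a z' q",
        OF vector_space_tensor _ _ _ that(3)])
    have zz: "z + z' \<in> C" using that subspace_add[OF subspace] by blast
    show "linear_on tensor_scale ?T tensor_scale UNIV (?a (z + z'))" by (rule a'[OF zz])
    show "linear_on tensor_scale ?T tensor_scale UNIV (\<lambda>q. ?a z q + ?a z' q)"
      by (rule linear_on_add[OF vector_space_tensor a'[OF that(1)] a'[OF that(2)]])
    show "?a (z + z') (pure_tensor s s x y) = ?a z (pure_tensor s s x y) + ?a z' (pure_tensor s s x y)"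
      if "x \<in> C" "y \<in> C" for x y
      unfolding a_pure[OF zz that] a_pure[OF \<open>z \<in> C\<close> that] a_pure[OF \<open>z' \<in> C\<close> that]
      by (rule pure)
  qed
  have a_scale: "?a (s k z) q = tensor_scale k (?a z q)" if "z \<in> C" "q \<in> ?T" for k z q
  proof (rule tensor_eqI[where f = "?a (s k z)" and g = "\<lambda>q. tensor_scale k (?a z q)",
        OF vector_space_tensor _ _ _ that(2)])
    have kz: "s k z \<in> C" using that subspace_scale[OF subspace] by blast
    show "linear_on tensor_scale ?T tensor_scale UNIV (?a (s k z))" by (rule a'[OF kz])
    show "linear_on tensor_scale ?T tensor_scale UNIV (\<lambda>q. tensor_scale k (?a z q))"
      by (rule linear_on_scale[OF vector_space_tensor a'[OF that(1)]])
    show "?a (s k z) (pure_tensor s s x y) = tensor_scale k (?a z (pure_tensor s s x y))"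
      if "x \<in> C" "y \<in> C" for x y
      unfolding a_pure[OF kz that] a_pure[OF \<open>z \<in> C\<close> that] by (rule pure)
  qed
  have bassoc: "bilinear_on tensor_scale ?T s C tensor_scale ?CT (\<lambda>q z. ?a z q)"
    unfolding bilinear_on_def
  proof (intro conjI ballI)
    show "linear_on tensor_scale ?T tensor_scale ?CT (?a z)" if "z \<in> C" for z by (rule a[OF that])
    then show "linear_on s C tensor_scale ?CT (\<lambda>z. ?a z q)" if "q \<in> ?T" for q
      using that by (simp add: linear_on_def a_add a_scale)
  qed
  then have bassoc': "bilinear_on tensor_scale ?T s C tensor_scale UNIV (\<lambda>q z. ?a z q)"
    unfolding bilinear_on_def linear_on_def by blast
  note assoc = tensor_lift_linear_into[OF X L linear_subspace_tensor bassoc, folded tensor_assoc_def]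
  note assoc_pure = tensor_lift_pure[OF X L vector_space_tensor bassoc', folded tensor_assoc_def]
  \<comment> \<open>\<open>tensor_assoc\<close> nests two lifts, so the comparison has two stages:
    the inner lift here, with \<open>z\<close> fixed, and the outer one in
    \<open>N_assoc\<close>.\<close>
  have N_a: "N (?a z q) = mult (M f g q) (h z)" if z: "z \<in> C" and q: "q \<in> ?T" for z q
  proof (rule tensor_eqI[OF target _ _ _ q])
    show "linear_on tensor_scale ?T t UNIV (\<lambda>q. N (?a z q))"
      by (rule linear_on_comp[OF a[OF z] N])
    show "linear_on tensor_scale ?T t UNIV (\<lambda>q. mult (M f g q) (h z))"
      using bN' z by (simp add: bilinear_on_def)
    show "N (?a z (pure_tensor s s x y)) = mult (M f g (pure_tensor s s x y)) (h z)"
      if "x \<in> C" "y \<in> C" for x y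
      using that z f g h by (simp add: a_pure N_pure M_pure pure_tensor_in mult_simps)
  qed
  have N_assoc: "N (tensor_assoc s C p) = N' p" if p: "p \<in> tensor_space tensor_scale ?T s C" for p
    by (rule tensor_eqI[OF target linear_on_comp[OF assoc N] N' _ p])
      (simp add: assoc_pure N_a N'_pure)
  show "?conv (?conv f g) h c = ?conv f (?conv g h) c"
  proof (cases "c \<in> C")
    case True
    note \<Delta>c = \<delta>_in[OF True]
    have fg: "?conv f g \<in> H" and gh: "?conv g h \<in> H" using f g h convolution_in by blast+
    have id: "linear_on s C s C id" by (rule linear_on_id) simp
    have "?conv (?conv f g) h c = M (?conv f g) h (\<Delta> c)" by (rule conv[OF fg h True])
    \<comment> \<open>Writing \<open>id w\<close> makes the term an instance of
      \<open>tensor_lift_map\<close> with \<open>\<Delta>\<close> and \<open>id\<close>.\<close>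
    also have "\<dots> = tensor_lift s C s C t (\<lambda>v w. mult (M f g (\<Delta> v)) (h (id w))) (\<Delta> c)"
      unfolding M_def[of "?conv f g"]
      by (rule tensor_lift_cong[OF L L target bilinear_mult[OF fg[THEN hom_linear] h[THEN hom_linear]]
            bilinear_on_comp[OF bN' \<delta> id] _ \<Delta>c]) (simp add: conv f g)
    also have "\<dots> = N' (tensor_map s C s C tensor_scale s \<Delta> id (\<Delta> c))"
      unfolding N'_def by (rule tensor_lift_map[OF L L X L target \<delta> id bN' \<Delta>c, symmetric])
    also have "\<dots> = N (tensor_assoc s C (tensor_map s C s C tensor_scale s \<Delta> id (\<Delta> c)))"
      using tensor_map_linear[OF L L \<delta> id] \<Delta>c by (intro N_assoc[symmetric]) (simp add: linear_on_def)
    also have "\<dots> = N (tensor_map s C s C s tensor_scale id \<Delta> (\<Delta> c))"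
      using coalg True by (simp add: coalgebra_def)
    also have "\<dots> = tensor_lift s C s C t (\<lambda>v w. mult (f (id v)) (M g h (\<Delta> w))) (\<Delta> c)"
      unfolding N_def by (rule tensor_lift_map[OF L L L X target id \<delta> bN \<Delta>c])
    also have "\<dots> = M f (?conv g h) (\<Delta> c)"
      unfolding M_def[of f "?conv g h"]
      by (rule tensor_lift_cong[OF L L target bilinear_on_comp[OF bN id \<delta>]
            bilinear_mult[OF f[THEN hom_linear] gh[THEN hom_linear]] _ \<Delta>c]) (simp add: conv g h)
    also have "\<dots> = ?conv f (?conv g h) c" by (rule conv[OF f gh True, symmetric])
    finally show ?thesis .
  \<comment> \<open>Outside \<open>C\<close> both sides have the default value
    \<open>0\<close>.\<close>
  qed (simp add: convolution_def)
qed

section \<open>Transport of convolutions along maps\<close>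

definition pullback :: "'v set \<Rightarrow> ('v \<Rightarrow> 'w) \<Rightarrow> ('w \<Rightarrow> 'a::zero) \<Rightarrow> 'v \<Rightarrow> 'a" where
  "pullback C \<gamma> f = (\<lambda>x. if x \<in> C then f (\<gamma> x) else 0)"

lemma pullback_in_hom_space:
  assumes "linear_subspace s C" "linear_on s C s' D \<gamma>" "f \<in> hom_space s' D t UNIV"
  shows "pullback C \<gamma> f \<in> hom_space s C t UNIV"
proof -
  interpret linear_subspace s C by fact
  show ?thesis
    using assms(2,3) subspace_add[OF subspace] subspace_scale[OF subspace]
    by (simp add: hom_space_def pullback_def linear_on_def)
qed

text \<open>Composing with \<open>\<gamma>\<close> moves \<open>\<alpha>\<close> and
  \<open>\<beta>\<close> from the comultiplication into the two factors. Different choices of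
  \<open>\<alpha>\<close>, \<open>\<beta>\<close>, \<open>\<gamma>\<close> among \<open>id\<close>
  and \<open>\<Phi>\<close> give the component formulas of all three products.\<close>

lemma pullback_convolution:
  assumes C: "convolution_space s C t mult \<Delta>" and D: "convolution_space s D t mult \<delta>"
    and \<alpha>: "linear_on s C s D \<alpha>" and \<beta>: "linear_on s C s D \<beta>"
    and \<gamma>: "\<And>c. c \<in> C \<Longrightarrow> \<gamma> c \<in> D \<and> \<delta> (\<gamma> c) = tensor_map s C s C s s \<alpha> \<beta> (\<Delta> c)"
    and f: "f \<in> hom_space s D t UNIV" and g: "g \<in> hom_space s D t UNIV"
  shows "pullback C \<gamma> (convolution s D t mult \<delta> f g) =
    convolution s C t mult \<Delta> (pullback C \<alpha> f) (pullback C \<beta> g)"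
proof (rule ext)
  fix c
  interpret C: convolution_space s C t mult \<Delta> by fact
  interpret D: convolution_space s D t mult \<delta> by fact
  note LC = C.linear_subspace_axioms and LD = D.linear_subspace_axioms
  note fg = f[THEN D.hom_linear] g[THEN D.hom_linear]
  note pb = pullback_in_hom_space[OF LC \<alpha> f, THEN C.hom_linear]
    pullback_in_hom_space[OF LC \<beta> g, THEN C.hom_linear]
  show "pullback C \<gamma> (convolution s D t mult \<delta> f g) c =
    convolution s C t mult \<Delta> (pullback C \<alpha> f) (pullback C \<beta> g) c"
  proof (cases "c \<in> C")
    case True
    have "pullback C \<gamma> (convolution s D t mult \<delta> f g) c =
        tensor_lift s D s D t (\<lambda>v w. mult (f v) (g w)) (tensor_map s C s C s s \<alpha> \<beta> (\<Delta> c))"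
      using \<gamma> True by (simp add: pullback_def D.convolution_eq_lift[OF fg])
    also have "\<dots> = tensor_lift s C s C t (\<lambda>v w. mult (f (\<alpha> v)) (g (\<beta> w))) (\<Delta> c)"
      by (rule tensor_lift_map[OF LC LC LD LD C.target \<alpha> \<beta> D.bilinear_mult[OF fg]
            C.\<delta>_in[OF True]])
    also have "\<dots> = tensor_lift s C s C t
        (\<lambda>v w. mult (pullback C \<alpha> f v) (pullback C \<beta> g w)) (\<Delta> c)"
      by (rule tensor_lift_cong[OF LC LC C.target
            bilinear_on_comp[OF D.bilinear_mult[OF fg] \<alpha> \<beta>] C.bilinear_mult[OF pb]
            _ C.\<delta>_in[OF True]]) (simp add: pullback_def)
    also have "\<dots> = convolution s C t mult \<Delta> (pullback C \<alpha> f) (pullback C \<beta> g) c"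
      by (rule C.convolution_eq_lift[OF pb True, symmetric])
    finally show ?thesis .
  qed (simp add: pullback_def convolution_def)
qed

text \<open>Brings agreement with \<open>\<Delta>1\<close> on \<open>C1\<close> into the form that
  \<open>pullback_convolution\<close> expects, with \<open>id\<close> for all three maps.\<close>

lemma tensor_map_id:
  assumes "linear_subspace s C" "q \<in> tensor_space s C s C"
  shows "tensor_map s C s C s s id id q = q"
proof -
  have id: "linear_on s C s C id" by (rule linear_on_id) simp
  show ?thesis
    by (rule tensor_eqI[OF vector_space_tensor tensor_map_linear[OF assms(1,1) id id] _ _ assms(2)])
      (auto simp: linear_on_def tensor_map_pure[OF assms(1,1) id id])
qed


section \<open>Dialgebras and Leibniz algebras\<close>

text \<open>The dialgebra laws, oriented as in \<open>di\<close>, nest every triple product to the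
  right. On the right-hand side of the Leibniz identity \<open>l x (l z y)\<close> and
  \<open>r y (r z x)\<close> then cancel, and the other four terms form the left-hand side.\<close>

lemma dialgebra_leibniz:
  assumes "assoc_dialgebra s V l r"
  shows "leibniz_algebra s V (\<lambda>x y. l x y - r y x)"
proof -
  have s: "vector_space s" and V: "module.subspace s V"
    and l: "bilinear_on s V s V s V l" and r: "bilinear_on s V s V s V r"
    using assms by (auto simp: assoc_dialgebra_def assoc_algebra_def)
  interpret vector_space s by fact
  note sub = subspace_add[OF V] subspace_diff[OF V] subspace_scale[OF V]
  have in_V: "l x y \<in> V" "r x y \<in> V" if "x \<in> V" "y \<in> V" for x y
    using l r that by (auto simp: bilinear_on_def linear_on_def)
  have add: "l (x + y) z = l x z + l y z" "l z (x + y) = l z x + l z y"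
    "r (x + y) z = r x z + r y z" "r z (x + y) = r z x + r z y"
    if "x \<in> V" "y \<in> V" "z \<in> V" for x y z
    using l r that by (auto simp: bilinear_on_def linear_on_def)
  have scale: "l (s c x) z = s c (l x z)" "l z (s c x) = s c (l z x)"
    "r (s c x) z = s c (r x z)" "r z (s c x) = s c (r z x)"
    if "x \<in> V" "z \<in> V" for c x z
    using l r that by (auto simp: bilinear_on_def linear_on_def)
  \<comment> \<open>Additivity at \<open>x - y\<close> and \<open>y\<close>, whose sum is
    \<open>x\<close>.\<close>
  have diff: "l (x - y) z = l x z - l y z" "l z (x - y) = l z x - l z y"
    "r (x - y) z = r x z - r y z" "r z (x - y) = r z x - r z y"
    if "x \<in> V" "y \<in> V" "z \<in> V" for x y z
    using add[of "x - y" y z] that sub(2) by (simp_all add: algebra_simps)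
  have di: "l (l x y) z = l x (l y z)" "r (r x y) z = r x (r y z)"
    "l x (r y z) = l x (l y z)" "l (r x y) z = r x (l y z)" "r (l x y) z = r x (r y z)"
    if "x \<in> V" "y \<in> V" "z \<in> V" for x y z
    using assms that unfolding assoc_dialgebra_def assoc_algebra_def by metis+
  have bil: "bilinear_on s V s V s V (\<lambda>x y. l x y - r y x)"
    unfolding bilinear_on_def linear_on_def
    using sub by (auto simp: in_V add scale scale_right_diff_distrib)
  have leibniz: "l (l x y - r y x) z - r z (l x y - r y x) =
      (l (l x z - r z x) y - r y (l x z - r z x)) + (l x (l y z - r z y) - r (l y z - r z y) x)"
    if "x \<in> V" "y \<in> V" "z \<in> V" for x y z
    using that by (simp add: in_V diff di)
  show ?thesis
    unfolding leibniz_algebra_def by (intro conjI ballI s V bil leibniz)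
qed

section \<open>The three products on maps from \<open>C1 + C2\<close>\<close>

theorem corollary2p15:
  fixes sE :: "'k::real_or_complex \<Rightarrow> 'e \<Rightarrow> 'e::ab_group_add"
    and sA :: "'k \<Rightarrow> 'a \<Rightarrow> 'a::ab_group_add"
    and C1 C2 D :: "'e set"
    and \<Delta>1 \<Delta>2 \<Delta>s \<delta>1 \<delta>1' :: "'e \<Rightarrow> ('k, 'e, 'e) tensor"
    and \<epsilon>1 \<epsilon>2 :: "'e \<Rightarrow> 'k"
    and \<Phi> :: "'e \<Rightarrow> 'e"
    and mult :: "'a \<Rightarrow> 'a \<Rightarrow> 'a"
  assumes "vector_space sE" and "countable_dimensional sE"
    and "coalgebra sE C1 \<Delta>1 \<epsilon>1" and "coalgebra sE C2 \<Delta>2 \<epsilon>2"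
    and "channel_map sE C1 \<Delta>1 \<epsilon>1 C2 \<Delta>2 \<epsilon>2 \<Phi>"
    and "D = {x + y |x y. x \<in> C1 \<and> y \<in> C2}"
    and "linear_on sE D tensor_scale (tensor_space sE D sE D) \<Delta>s"
    and "linear_on sE D tensor_scale (tensor_space sE D sE D) \<delta>1"
    and "linear_on sE D tensor_scale (tensor_space sE D sE D) \<delta>1'"
    and "\<forall>c\<in>C1. \<Delta>s c = \<Delta>1 c" and "\<forall>c\<in>C2. \<Delta>s c = \<Delta>2 c"
    and "\<forall>c\<in>C1. \<delta>1 c = \<Delta>1 c"
    and "\<forall>c\<in>C1. \<delta>1 (\<Phi> c) = tensor_map sE C1 sE C1 sE sE id \<Phi> (\<Delta>1 c)"
    and "\<forall>c\<in>C1. \<delta>1' c = \<Delta>1 c"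
    and "\<forall>c\<in>C1. \<delta>1' (\<Phi> c) = tensor_map sE C1 sE C1 sE sE \<Phi> id (\<Delta>1 c)"
    and "assoc_algebra sA UNIV mult" and "countable_dimensional sA"
  defines "L \<equiv> hom_space sE D sA UNIV"
    and "perp \<equiv> convolution sE D sA mult \<Delta>s"
    and "dashv \<equiv> convolution sE D sA mult \<delta>1'"
    and "vdash \<equiv> convolution sE D sA mult \<delta>1"
  shows "assoc_dialgebra (fun_scale sA) L dashv vdash \<and>
         leibniz_algebra (fun_scale sA) L (\<lambda>f g. dashv f g - vdash g f) \<and>
         assoc_trialgebra (fun_scale sA) L dashv vdash perp"
proof -
  \<comment> \<open>\<open>S\<close> is the product of the convolution algebra of \<open>C1\<close>;
    \<open>p1 f\<close> and \<open>p2 f\<close> are the two components of the pair attached to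
    \<open>f\<close>.\<close>
  define S where "S = convolution sE C1 sA mult \<Delta>1"
  define p1 where "p1 = (pullback C1 id :: ('e \<Rightarrow> 'a) \<Rightarrow> _)"
  define p2 where "p2 = (pullback C1 \<Phi> :: ('e \<Rightarrow> 'a) \<Rightarrow> _)"
  interpret E: vector_space sE by fact
  have sub1: "E.subspace C1" and sub2: "E.subspace C2"
    and \<Delta>1: "linear_on sE C1 tensor_scale (tensor_space sE C1 sE C1) \<Delta>1"
    using assms(3,4) by (simp_all add: coalgebra_def)
  have \<Phi>: "linear_on sE C1 sE C2 \<Phi>" "\<Phi> ` C1 = C2"
    and \<Delta>2: "\<And>c. c \<in> C1 \<Longrightarrow> \<Delta>2 (\<Phi> c) = tensor_map sE C1 sE C1 sE sE \<Phi> \<Phi> (\<Delta>1 c)"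
    using assms(5) by (auto simp: channel_map_def bij_betw_def)
  have CD: "C1 \<subseteq> D" "C2 \<subseteq> D"
    unfolding assms(6) using E.subspace_0[OF sub1] E.subspace_0[OF sub2] by force+
  have subD: "E.subspace D" unfolding assms(6) by (rule E.subspace_sums[OF sub1 sub2])
  have LC: "linear_subspace sE C1" using sub1 by unfold_locales
  have LD: "linear_subspace sE D" using subD by unfold_locales
  have C: "convolution_space sE C1 sA mult \<Delta>1"
    by (intro convolution_space.intro convolution_space_axioms.intro LC \<Delta>1 assms)
  have Ds: "convolution_space sE D sA mult \<Delta>s" "convolution_space sE D sA mult \<delta>1"
    "convolution_space sE D sA mult \<delta>1'"
    by (intro convolution_space.intro convolution_space_axioms.intro LD assms)+
  interpret C: convolution_space sE C1 sA mult \<Delta>1 by (rule C)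
  have idD: "linear_on sE C1 sE D id" by (rule linear_on_id[OF CD(1)])
  have \<Phi>D: "linear_on sE C1 sE D \<Phi>" using \<Phi>(1) CD(2) by (auto simp: linear_on_def)
  have \<Phi>_in: "\<Phi> c \<in> C2" "\<Phi> c \<in> D" if "c \<in> C1" for c using \<Phi>(2) CD that by auto

  have on_C1: "id c \<in> D \<and> \<delta> (id c) = tensor_map sE C1 sE C1 sE sE id id (\<Delta>1 c)"
    if "\<forall>c\<in>C1. \<delta> c = \<Delta>1 c" "c \<in> C1" for \<delta> c
    using that CD(1) by (auto simp: tensor_map_id[OF LC C.\<delta>_in])
  \<comment> \<open>For \<open>\<Delta>s\<close> this combines its agreement with
    \<open>\<Delta>2\<close> on \<open>C2\<close> and the compatibility of \<open>\<Phi>\<close>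
    with the comultiplications.\<close>
  have on_C2: "\<Phi> c \<in> D \<and> \<Delta>s (\<Phi> c) = tensor_map sE C1 sE C1 sE sE \<Phi> \<Phi> (\<Delta>1 c)"
    "\<Phi> c \<in> D \<and> \<delta>1 (\<Phi> c) = tensor_map sE C1 sE C1 sE sE id \<Phi> (\<Delta>1 c)"
    "\<Phi> c \<in> D \<and> \<delta>1' (\<Phi> c) = tensor_map sE C1 sE C1 sE sE \<Phi> id (\<Delta>1 c)"
    if "c \<in> C1" for c
    using that \<Phi>_in[OF that] \<Delta>2[OF that] assms(11,13,15) by simp_all
  have pullback: "p1 (perp f g) = S (p1 f) (p1 g)" "p1 (dashv f g) = S (p1 f) (p1 g)"
    "p1 (vdash f g) = S (p1 f) (p1 g)"
    "p2 (perp f g) = S (p2 f) (p2 g)" "p2 (dashv f g) = S (p2 f) (p1 g)"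
    "p2 (vdash f g) = S (p1 f) (p2 g)"
    if fg: "f \<in> L" "g \<in> L" for f g
  proof -
    note pullback = pullback_convolution[OF C _ _ _ _ fg[unfolded L_def]]
    note defs = p1_def p2_def S_def perp_def dashv_def vdash_def
    show "p1 (perp f g) = S (p1 f) (p1 g)"
      unfolding defs by (rule pullback[OF Ds(1) idD idD on_C1[OF assms(10)]])
    show "p1 (dashv f g) = S (p1 f) (p1 g)"
      unfolding defs by (rule pullback[OF Ds(3) idD idD on_C1[OF assms(14)]])
    show "p1 (vdash f g) = S (p1 f) (p1 g)"
      unfolding defs by (rule pullback[OF Ds(2) idD idD on_C1[OF assms(12)]])
    show "p2 (perp f g) = S (p2 f) (p2 g)"
      unfolding defs by (rule pullback[OF Ds(1) \<Phi>D \<Phi>D on_C2(1)])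
    show "p2 (dashv f g) = S (p2 f) (p1 g)"
      unfolding defs by (rule pullback[OF Ds(3) \<Phi>D idD on_C2(3)])
    show "p2 (vdash f g) = S (p1 f) (p2 g)"
      unfolding defs by (rule pullback[OF Ds(2) idD \<Phi>D on_C2(2)])
  qed
  have p_in: "p1 f \<in> C.H" "p2 f \<in> C.H" if "f \<in> L" for f
    using that unfolding L_def p1_def p2_def
    by (blast intro: pullback_in_hom_space[OF LC idD] pullback_in_hom_space[OF LC \<Phi>D])+
  have S_assoc: "S (S f g) h = S f (S g h)" if "f \<in> C.H" "g \<in> C.H" "h \<in> C.H" for f g h
    unfolding S_def by (rule convolution_assoc[OF assms(3,16) that])
  \<comment> \<open>Surjectivity of \<open>\<Phi>\<close> onto \<open>C2\<close> turns equal second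
    components into agreement on \<open>C2\<close>; additivity extends it to \<open>D\<close>, and
    outside \<open>D\<close> both maps are \<open>0\<close>.\<close>
  have eqI: "f = g" if "f \<in> L" "g \<in> L" "p1 f = p1 g" "p2 f = p2 g" for f g
  proof
    fix x
    have 1: "f c = g c" if "c \<in> C1" for c
      using fun_cong[OF \<open>p1 f = p1 g\<close>, of c] that by (simp add: p1_def pullback_def)
    have 2: "f c = g c" if "c \<in> C2" for c
    proof -
      obtain b where "b \<in> C1" "c = \<Phi> b" using \<open>c \<in> C2\<close> \<Phi>(2) by blast
      then show ?thesis
        using fun_cong[OF \<open>p2 f = p2 g\<close>, of b] by (simp add: p2_def pullback_def)
    qed
    show "f x = g x"
    proof (cases "x \<in> D")
      case True
      then obtain a b where "x = a + b" "a \<in> C1" "b \<in> C2" unfolding assms(6) by auto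
      then show ?thesis
        using \<open>f \<in> L\<close> \<open>g \<in> L\<close> CD 1 2 by (auto simp: L_def hom_space_def linear_on_def subset_iff)
    next
      case False
      then show ?thesis using \<open>f \<in> L\<close> \<open>g \<in> L\<close> by (auto simp: L_def hom_space_def)
    qed
  qed
  have closed: "perp f g \<in> L" "dashv f g \<in> L" "vdash f g \<in> L" if "f \<in> L" "g \<in> L" for f g
    using that Ds[THEN convolution_space.convolution_in]
    unfolding L_def perp_def dashv_def vdash_def by blast+
  have bil: "bilinear_on (fun_scale sA) L (fun_scale sA) L (fun_scale sA) L p"
    if "p \<in> {perp, dashv, vdash}" for p
    using that Ds[THEN convolution_space.bilinear_convolution]
    unfolding L_def perp_def dashv_def vdash_def by blast
  have L: "vector_space (fun_scale sA :: _ \<Rightarrow> ('e \<Rightarrow> 'a) \<Rightarrow> _)" "module.subspace (fun_scale sA) L"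
    using linear_subspace_hom_space[OF LD C.target]
    by (auto simp: L_def linear_subspace_def linear_subspace_axioms_def)
  note simps = pullback closed p_in S_assoc
  have assoc: "p (p x y) z = p x (p y z)"
    if "p \<in> {perp, dashv, vdash}" "x \<in> L" "y \<in> L" "z \<in> L" for p x y z
    by (rule eqI; insert that; elim insertE emptyE; simp add: simps)
  have alg: "assoc_algebra (fun_scale sA) L p" if "p \<in> {perp, dashv, vdash}" for p
    unfolding assoc_algebra_def by (intro conjI ballI L bil assoc that)
  \<comment> \<open>\<open>dashv\<close> sees only the first component of its right argument,
    \<open>vdash\<close> only that of its left one, and all three products have the same first
    component. Up to associativity of \<open>S\<close>, the mixed identities therefore hold
    componentwise.\<close>
  have di: "assoc_dialgebra (fun_scale sA) L dashv vdash"
    unfolding assoc_dialgebra_def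
    by (intro conjI ballI alg; (simp; fail)?; rule eqI; simp add: simps)
  have "assoc_trialgebra (fun_scale sA) L dashv vdash perp"
    unfolding assoc_trialgebra_def
    by (intro conjI ballI alg di; (simp; fail)?; rule eqI; simp add: simps)
  with di dialgebra_leibniz[OF di] show ?thesis by blast
qed

end
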